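(* Let $n\ge 1$ be an integer and let $V_{8n}=\langle a,b : a^{2n}=b^4=1,\ ba=a^{-1}b^{-1},\ b^{-1}a=a^{-1}b\rangle$. Then \[ \mathrm{OSCom}(V_{8n})\cong\begin{cases}K_{8n}, & \text{if } n \text{ is even},\\ K_{2n+4}\vee(K_{2n}\sqcup K_{4n-4}), & \text{if } n \text{ is odd}.\end{cases} \]
   Context: For a finite group $G$, the order super commuting graph $\mathrm{OSCom}(G)$ is the simple graph with vertex set $G$ in which two distinct vertices $g,h$ are adjacent if and only if either $g$ and $h$ have the same order, or there exist $g',h'\in G$ such that $g'$ has the same order as $g$, $h'$ has the same order as $h$, and $g'h'=h'g'$. $K_r$ is the complete graph on $r$ vertices ($K_0$ is the empty graph), $\sqcup$ is disjoint union of graphs, and $\vee$ is the join of graphs (disjoint union together with all edges between the two vertex sets). *)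

theory Defs
  imports "HOL-Algebra.Multiplicative_Group" "Graph_Theory.Graph_Theory"
begin

section \<open>Groups given by generators and relations\<close>

text \<open>
  The generators are the elements of a type \<open>'x\<close>. The letter \<open>(x, True)\<close> stands for the generator
  \<open>x\<close> and \<open>(x, False)\<close> for its formal inverse. A set \<open>R\<close> of pairs of words is read as the set of
  relations \<open>u = v\<close> with \<open>(u, v) \<in> R\<close>. The group presented by \<open>R\<close> is the set of words modulo the
  smallest congruence that cancels adjacent inverse letters and identifies the two sides of every
  relation in \<open>R\<close>. (With \<open>R = {}\<close> this is the free group; in general it is the free group modulo the
  normal closure of the words \<open>u v\<^sup>-\<^sup>1\<close>.)
\<close>

type_synonym 'x word = "('x \<times> bool) list"

definition gen :: "'x \<Rightarrow> 'x word" where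
  "gen x = [(x, True)]"

definition word_inv :: "'x word \<Rightarrow> 'x word" where
  "word_inv w = rev (map (\<lambda>(x, e). (x, \<not> e)) w)"

definition word_pow :: "'x word \<Rightarrow> nat \<Rightarrow> 'x word" where
  "word_pow w k = concat (replicate k w)"

inductive_set word_cong :: "('x word \<times> 'x word) set \<Rightarrow> ('x word \<times> 'x word) set"
  for R :: "('x word \<times> 'x word) set" where
  relation: "(u, v) \<in> R \<Longrightarrow> (u, v) \<in> word_cong R"
| cancel: "([(x, e), (x, \<not> e)], []) \<in> word_cong R"
| refl: "(u, u) \<in> word_cong R"
| sym: "(u, v) \<in> word_cong R \<Longrightarrow> (v, u) \<in> word_cong R"
| trans: "(u, v) \<in> word_cong R \<Longrightarrow> (v, w) \<in> word_cong R \<Longrightarrow> (u, w) \<in> word_cong R"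
| append: "(u, u') \<in> word_cong R \<Longrightarrow> (v, v') \<in> word_cong R \<Longrightarrow> (u @ v, u' @ v') \<in> word_cong R"

definition presented_group :: "('x word \<times> 'x word) set \<Rightarrow> 'x word set monoid" where
  "presented_group R =
    \<lparr>carrier = UNIV // word_cong R,
     monoid.mult = (\<lambda>X Y. \<Union>u\<in>X. \<Union>v\<in>Y. word_cong R `` {u @ v}),
     monoid.one = word_cong R `` {[]}\<rparr>"

lemma equiv_word_cong: "equiv UNIV (word_cong R)"
proof (rule equivI)
  show "refl (word_cong R)" by (rule refl_onI) (rule word_cong.refl)
  show "sym (word_cong R)" by (rule symI) (rule word_cong.sym)
  show "trans (word_cong R)" by (rule transI) (rule word_cong.trans)
qed simp

lemma word_cong_class_eq_iff:
  "word_cong R `` {u} = word_cong R `` {v} \<longleftrightarrow> (u, v) \<in> word_cong R"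
  by (rule eq_equiv_class_iff[OF equiv_word_cong]) auto

lemma one_presented_group: "\<one>\<^bsub>presented_group R\<^esub> = word_cong R `` {[]}"
  by (simp add: presented_group_def)

lemma carrier_presented_group: "carrier (presented_group R) = range (\<lambda>u. word_cong R `` {u})"
  by (auto simp: presented_group_def quotient_def)

lemma mult_presented_group:
  "word_cong R `` {u} \<otimes>\<^bsub>presented_group R\<^esub> word_cong R `` {v} = word_cong R `` {u @ v}"
proof -
  have "word_cong R `` {u' @ v'} = word_cong R `` {u @ v}"
    if "(u, u') \<in> word_cong R" "(v, v') \<in> word_cong R" for u' v'
    unfolding word_cong_class_eq_iff
    by (rule word_cong.sym, rule word_cong.append) (rule that)+
  then have "(\<Union>u'\<in>word_cong R `` {u}. \<Union>v'\<in>word_cong R `` {v}. word_cong R `` {u' @ v'}) =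
      (\<Union>u'\<in>word_cong R `` {u}. \<Union>v'\<in>word_cong R `` {v}. word_cong R `` {u @ v})"
    by (intro SUP_cong) simp_all
  also have "\<dots> = word_cong R `` {u @ v}"
  proof -
    have "u \<in> word_cong R `` {u}" "v \<in> word_cong R `` {v}"
      by (simp_all add: word_cong.refl)
    then show ?thesis by blast
  qed
  finally show ?thesis
    by (simp add: presented_group_def)
qed

lemma word_inv_left: "(word_inv w @ w, []) \<in> word_cong R"
proof (induction w)
  case Nil
  then show ?case by (simp add: word_inv_def word_cong.refl)
next
  case (Cons l w)
  obtain x e where l: "l = (x, e)" by (cases l)
  have "([(x, \<not> e), (x, e)], []) \<in> word_cong R"
    using word_cong.cancel[of x "\<not> e" R] by simp
  then have "(word_inv w @ ([(x, \<not> e), (x, e)] @ w), word_inv w @ ([] @ w)) \<in> word_cong R"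
    by (intro word_cong.append word_cong.refl)
  then have "(word_inv (l # w) @ (l # w), word_inv w @ w) \<in> word_cong R"
    by (simp add: word_inv_def l)
  then show ?case using Cons.IH by (rule word_cong.trans)
qed

lemma group_presented_group: "group (presented_group R)"
proof (rule groupI)
  fix X assume "X \<in> carrier (presented_group R)"
  then obtain u where u: "X = word_cong R `` {u}" by (auto simp: carrier_presented_group)
  have "word_cong R `` {word_inv u} \<otimes>\<^bsub>presented_group R\<^esub> X = \<one>\<^bsub>presented_group R\<^esub>"
    by (simp add: u mult_presented_group one_presented_group word_cong_class_eq_iff word_inv_left)
  then show "\<exists>Y\<in>carrier (presented_group R). Y \<otimes>\<^bsub>presented_group R\<^esub> X = \<one>\<^bsub>presented_group R\<^esub>"
    by (auto simp: carrier_presented_group)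
qed (auto simp: carrier_presented_group mult_presented_group one_presented_group)

text \<open>The universal property: an assignment of the generators to elements of a group that
  satisfies the relations extends to a unique homomorphism.\<close>

fun word_eval :: "('g, 'm) monoid_scheme \<Rightarrow> ('x \<Rightarrow> 'g) \<Rightarrow> 'x word \<Rightarrow> 'g" where
  "word_eval H f [] = \<one>\<^bsub>H\<^esub>"
| "word_eval H f ((x, e) # w) = (if e then f x else inv\<^bsub>H\<^esub> f x) \<otimes>\<^bsub>H\<^esub> word_eval H f w"

lemma word_eval_closed:
  assumes "group H" "\<And>x. f x \<in> carrier H"
  shows "word_eval H f w \<in> carrier H"
proof -
  interpret group H by fact
  show ?thesis using assms(2) by (induction w) auto
qed

lemma word_eval_append:
  assumes "group H" "\<And>x. f x \<in> carrier H"
  shows "word_eval H f (u @ v) = word_eval H f u \<otimes>\<^bsub>H\<^esub> word_eval H f v"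
proof -
  interpret group H by fact
  show ?thesis
    using assms(2) by (induction u) (auto simp: word_eval_closed[OF assms] m_assoc)
qed

lemma word_eval_cong:
  assumes "group H" "\<And>x. f x \<in> carrier H"
    and "\<And>u v. (u, v) \<in> R \<Longrightarrow> word_eval H f u = word_eval H f v"
    and "(u, v) \<in> word_cong R"
  shows "word_eval H f u = word_eval H f v"
proof -
  interpret group H by fact
  show ?thesis
    using assms(4)
    by induction (auto simp: assms(2,3) word_eval_append[OF assms(1,2)])
qed

theorem presented_group_universal:
  assumes "group H" "\<And>x. f x \<in> carrier H"
    and "\<And>u v. (u, v) \<in> R \<Longrightarrow> word_eval H f u = word_eval H f v"
  shows "\<exists>h\<in>hom (presented_group R) H. \<forall>w. h (word_cong R `` {w}) = word_eval H f w"
proof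
  define h where "h X = word_eval H f (SOME w. w \<in> X)" for X
  have h: "h (word_cong R `` {w}) = word_eval H f w" for w
  proof -
    have "(SOME v. v \<in> word_cong R `` {w}) \<in> word_cong R `` {w}"
      by (rule someI[of _ w]) (simp add: word_cong.refl)
    then have "(w, SOME v. v \<in> word_cong R `` {w}) \<in> word_cong R"
      by simp
    from word_eval_cong[OF assms this] show ?thesis
      unfolding h_def by simp
  qed
  then show "\<forall>w. h (word_cong R `` {w}) = word_eval H f w" by blast
  show "h \<in> hom (presented_group R) H"
    by (rule homI) (auto simp: carrier_presented_group mult_presented_group h
        word_eval_closed[OF assms(1,2)] word_eval_append[OF assms(1,2)])
qed

theorem presented_group_hom_unique:
  assumes "group H" "h \<in> hom (presented_group R) H" "h' \<in> hom (presented_group R) H"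
    and "\<And>x. h (word_cong R `` {gen x}) = h' (word_cong R `` {gen x})"
    and "X \<in> carrier (presented_group R)"
  shows "h X = h' X"
proof -
  interpret P: group "presented_group R" by (rule group_presented_group)
  interpret H: group H by fact
  interpret h: group_hom "presented_group R" H h by unfold_locales (rule assms(2))
  interpret h': group_hom "presented_group R" H h' by unfold_locales (rule assms(3))
  have car: "word_cong R `` {u} \<in> carrier (presented_group R)" for u
    by (auto simp: carrier_presented_group)
  have letter: "h (word_cong R `` {[(x, e)]}) = h' (word_cong R `` {[(x, e)]})" for x e
  proof (cases e)
    case True
    then show ?thesis using assms(4)[of x] by (simp add: gen_def)
  next
    case False
    have "word_cong R `` {[(x, False)]} = inv\<^bsub>presented_group R\<^esub> (word_cong R `` {gen x})"
      using word_inv_left[of "gen x" R]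
      by (intro P.inv_equality[symmetric] car)
        (simp add: mult_presented_group one_presented_group word_cong_class_eq_iff
          gen_def word_inv_def)
    then show ?thesis using False assms(4)[of x] by (simp add: car)
  qed
  have "h (word_cong R `` {w}) = h' (word_cong R `` {w})" for w
  proof (induction w)
    case Nil
    then show ?case using h.hom_one h'.hom_one by (simp add: one_presented_group)
  next
    case (Cons l w)
    have "word_cong R `` {l # w} =
        word_cong R `` {[l]} \<otimes>\<^bsub>presented_group R\<^esub> word_cong R `` {w}"
      by (simp add: mult_presented_group)
    then show ?case using Cons letter[of "fst l" "snd l"] by (simp add: car)
  qed
  then show ?thesis using assms(5) by (auto simp: carrier_presented_group)
qed

section \<open>The group \<open>V\<^sub>8\<^sub>n\<close>\<close>

datatype V_gen = Gen_a | Gen_b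

definition V8n :: "nat \<Rightarrow> V_gen word set monoid" where
  "V8n n =
    (let a = gen Gen_a; b = gen Gen_b in
      presented_group
        {(word_pow a (2 * n), []),
         (word_pow b 4, []),
         (b @ a, word_inv a @ word_inv b),
         (word_inv b @ a, word_inv a @ b)})"

section \<open>Graphs\<close>

text \<open>A simple graph is represented, as in the library, by a symmetric irreflexive relation on its
  vertex set, and isomorphism is \<^const>\<open>digraph_iso\<close> of the associated digraphs.\<close>

definition OSCom :: "('g, 'm) monoid_scheme \<Rightarrow> 'g pair_pre_digraph" where
  "OSCom G =
    \<lparr>pverts = carrier G,
     parcs = {(g, h). g \<in> carrier G \<and> h \<in> carrier G \<and> g \<noteq> h \<and>
       (group.ord G g = group.ord G h \<or>
        (\<exists>g'\<in>carrier G. \<exists>h'\<in>carrier G.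
          group.ord G g' = group.ord G g \<and> group.ord G h' = group.ord G h \<and>
          g' \<otimes>\<^bsub>G\<^esub> h' = h' \<otimes>\<^bsub>G\<^esub> g'))}\<rparr>"

definition complete_graph :: "nat \<Rightarrow> nat pair_pre_digraph" where
  "complete_graph r = \<lparr>pverts = {..<r}, parcs = {(i, j). i < r \<and> j < r \<and> i \<noteq> j}\<rparr>"

definition graph_disjoint_union ::
    "'a pair_pre_digraph \<Rightarrow> 'b pair_pre_digraph \<Rightarrow> ('a + 'b) pair_pre_digraph" where
  "graph_disjoint_union G H =
    \<lparr>pverts = pverts G <+> pverts H,
     parcs = map_prod Inl Inl ` parcs G \<union> map_prod Inr Inr ` parcs H\<rparr>"

definition graph_join ::
    "'a pair_pre_digraph \<Rightarrow> 'b pair_pre_digraph \<Rightarrow> ('a + 'b) pair_pre_digraph" where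
  "graph_join G H =
    \<lparr>pverts = pverts (graph_disjoint_union G H),
     parcs = parcs (graph_disjoint_union G H) \<union>
       Inl ` pverts G \<times> Inr ` pverts H \<union> Inr ` pverts H \<times> Inl ` pverts G\<rparr>"

lemma pair_graphI_sym_irrefl:
  assumes "finite (pverts G)" "parcs G \<subseteq> pverts G \<times> pverts G"
    and "\<And>u v. (u, v) \<in> parcs G \<Longrightarrow> (v, u) \<in> parcs G \<and> u \<noteq> v"
  shows "pair_graph G"
proof
  show "finite (parcs G)"
    using assms(1,2) by (meson finite_SigmaI finite_subset)
  show "symmetric (with_proj G)"
    using assms(3) by (auto simp: symmetric_def intro: symI)
qed (use assms in auto)

lemma pair_graph_OSCom: "finite (carrier G) \<Longrightarrow> pair_graph (OSCom G)"
  by (rule pair_graphI_sym_irrefl) (force simp: OSCom_def)+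

lemma complete_digraph_complete_graph: "complete_digraph r (with_proj (complete_graph r))"
  by (auto simp: complete_digraph_pair_def complete_graph_def)

lemma pair_graph_graph_disjoint_union:
  assumes "pair_graph G" "pair_graph H"
  shows "pair_graph (graph_disjoint_union G H)"
proof -
  interpret G: pair_graph G by fact
  interpret H: pair_graph H by fact
  show ?thesis
    by (rule pair_graphI_sym_irrefl)
      (auto simp: graph_disjoint_union_def intro: G.arcs_symmetric H.arcs_symmetric
        dest: G.in_arcsD1 G.in_arcsD2 H.in_arcsD1 H.in_arcsD2 G.pair_no_loops H.pair_no_loops)
qed

lemma pair_graph_graph_join:
  assumes "pair_graph G" "pair_graph H"
  shows "pair_graph (graph_join G H)"
proof -
  interpret U: pair_graph "graph_disjoint_union G H"
    by (rule pair_graph_graph_disjoint_union) fact+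
  have "Inl ` pverts G \<subseteq> pverts (graph_disjoint_union G H)"
    "Inr ` pverts H \<subseteq> pverts (graph_disjoint_union G H)"
    by (auto simp: graph_disjoint_union_def)
  then show ?thesis
    by (intro pair_graphI_sym_irrefl)
      (auto simp: graph_join_def intro: U.arcs_symmetric
        dest: U.in_arcsD1 U.in_arcsD2 U.pair_no_loops)
qed

end

theory Submission
  imports Defs
begin

text \<open>
  The relations say that \<open>b\<^sup>2\<close> is central of order at most two and that \<open>b\<close> conjugates \<open>a\<close> to
  \<open>a\<^sup>-\<^sup>1 b\<^sup>2\<close>. Hence every element is \<open>a\<^sup>i b\<^sup>s\<close> with \<open>i\<close> modulo \<open>2n\<close> and \<open>s\<close> modulo \<open>4\<close>, and the
  products of these normal forms define a group law on \<open>8n\<close> pairs (\<open>group_V_model\<close>). That no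
  further collapse takes place follows from the universal property of the presentation
  (\<open>V8n_iso_V_model\<close>).

  Let \<open>A\<close> be the abelian subgroup of index two generated by \<open>a\<close> and \<open>b\<^sup>2\<close>. Two elements whose
  orders both occur in \<open>A\<close> are adjacent, since elements of \<open>A\<close> with these orders commute. An
  element outside \<open>A\<close> has as its square \<open>1\<close> or \<open>b\<^sup>2\<close>, so its order is \<open>2\<close> or \<open>4\<close>. The order \<open>2\<close> is
  that of the central element \<open>b\<^sup>2 \<in> A\<close>, so everything depends on whether \<open>A\<close> has an element of
  order \<open>4\<close>.

  If \<open>n\<close> is even, then \<open>a\<^bsup>n/2\<^esup>\<close> is such an element and the graph is complete
  (\<open>OSCom_V_model_even\<close>).

  If \<open>n\<close> is odd, then \<open>A\<close> has none, and the elements of order \<open>4\<close> are exactly the \<open>2n\<close> elements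
  \<open>a\<^sup>i b\<^sup>s\<close> with \<open>i\<close> even and \<open>s\<close> odd. The \<open>2n + 4\<close> elements of order \<open>1\<close> or \<open>2\<close> are adjacent to
  everything, because \<open>1\<close> and \<open>b\<^sup>2\<close> are central. The remaining \<open>4n - 4\<close> elements lie in \<open>A\<close>, so they
  are pairwise adjacent; none of them is adjacent to an element of order \<open>4\<close>, because an element
  of \<open>A\<close> that commutes with some element outside \<open>A\<close> satisfies \<open>x\<^sup>2 = 1\<close>
  (\<open>V_model_commute_odd\<close>). This is the decomposition in \<open>OSCom_V_model_odd\<close>.
\<close>

section \<open>Isomorphisms of simple graphs\<close>

lemma digraph_iso_trans:
  assumes "digraph_iso G H" "digraph_iso H K"
  shows "digraph_iso G K"
proof -
  obtain f g where f: "pre_digraph.digraph_isomorphism G f" "H = app_iso f G"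
    and g: "pre_digraph.digraph_isomorphism H g" "K = app_iso g H"
    using assms unfolding digraph_iso_def by blast
  let ?k = "\<lparr>iso_verts = iso_verts g \<circ> iso_verts f, iso_arcs = iso_arcs g \<circ> iso_arcs f,
      iso_head = iso_head g, iso_tail = iso_tail g\<rparr>"
  have "pre_digraph.digraph_isomorphism G ?k"
    using f g unfolding pre_digraph.digraph_isomorphism_def by (auto intro!: comp_inj_on)
  moreover have "K = app_iso ?k G"
    using f(2) g(2) by (simp add: app_iso_def image_comp)
  ultimately show ?thesis
    unfolding digraph_iso_def by blast
qed

lemma digraph_iso_with_projI:
  assumes bij: "bij_betw f (pverts G) (pverts H)"
    and wf: "parcs G \<subseteq> pverts G \<times> pverts G" "parcs H \<subseteq> pverts H \<times> pverts H"
    and arcs: "\<And>u v. u \<in> pverts G \<Longrightarrow> v \<in> pverts G \<Longrightarrow> (f u, f v) \<in> parcs H \<longleftrightarrow> (u, v) \<in> parcs G"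
  shows "digraph_iso (with_proj G) (with_proj H)"
proof -
  let ?k = "\<lparr>iso_verts = f, iso_arcs = map_prod f f, iso_head = snd, iso_tail = fst\<rparr>"
  have inj: "inj_on f (pverts G)" and im: "f ` pverts G = pverts H"
    using bij by (auto simp: bij_betw_def)
  have "inj_on (map_prod f f) (parcs G)"
    using wf(1) by (intro inj_on_subset[OF map_prod_inj_on[OF inj inj]])
  moreover have "wf_digraph (with_proj G)"
    using wf(1) by unfold_locales auto
  ultimately have "pre_digraph.digraph_isomorphism (with_proj G) ?k"
    using inj by (auto simp: pre_digraph.digraph_isomorphism_def)
  moreover have "parcs H = map_prod f f ` parcs G"
  proof
    show "map_prod f f ` parcs G \<subseteq> parcs H"
      using wf(1) arcs by auto
    show "parcs H \<subseteq> map_prod f f ` parcs G"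
    proof
      fix e assume e: "e \<in> parcs H"
      then obtain u v where "e = (f u, f v)" "u \<in> pverts G" "v \<in> pverts G"
        using wf(2) im by (cases e) blast
      then show "e \<in> map_prod f f ` parcs G"
        using e arcs by (auto intro!: rev_image_eqI[of "(u, v)"])
    qed
  qed
  then have "with_proj H = app_iso ?k (with_proj G)"
    using im by (simp add: with_proj_def app_iso_def)
  ultimately show ?thesis
    unfolding digraph_iso_def by blast
qed

lemma digraph_iso_complete_graphI:
  assumes "finite (pverts G)"
    and "parcs G = {(u, v). u \<in> pverts G \<and> v \<in> pverts G \<and> u \<noteq> v}"
  shows "digraph_iso (with_proj G) (with_proj (complete_graph (card (pverts G))))"
proof -
  obtain f where f: "bij_betw f (pverts G) {..<card (pverts G)}"
    using ex_bij_betw_finite_nat[OF assms(1)] by (auto simp: atLeast0LessThan)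
  then show ?thesis
    using assms(2)
    by (intro digraph_iso_with_projI[of f])
      (auto simp: complete_graph_def dest: bij_betwE bij_betw_imp_inj_on inj_onD)
qed

lemma parcs_complete_graph_iff: "(i, j) \<in> parcs (complete_graph r) \<longleftrightarrow> i < r \<and> j < r \<and> i \<noteq> j"
  by (simp add: complete_graph_def)

lemma parcs_graph_disjoint_union_iff:
  "(Inl a, Inl b) \<in> parcs (graph_disjoint_union G H) \<longleftrightarrow> (a, b) \<in> parcs G"
  "(Inr c, Inr d) \<in> parcs (graph_disjoint_union G H) \<longleftrightarrow> (c, d) \<in> parcs H"
  "(Inl a, Inr d) \<notin> parcs (graph_disjoint_union G H)"
  "(Inr c, Inl b) \<notin> parcs (graph_disjoint_union G H)"
  by (auto simp: graph_disjoint_union_def)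

lemma parcs_graph_join_iff:
  "(Inl a, Inl b) \<in> parcs (graph_join G H) \<longleftrightarrow> (a, b) \<in> parcs G"
  "(Inr c, Inr d) \<in> parcs (graph_join G H) \<longleftrightarrow> (c, d) \<in> parcs H"
  "(Inl a, Inr d) \<in> parcs (graph_join G H) \<longleftrightarrow> a \<in> pverts G \<and> d \<in> pverts H"
  "(Inr c, Inl b) \<in> parcs (graph_join G H) \<longleftrightarrow> c \<in> pverts H \<and> b \<in> pverts G"
  by (auto simp: graph_join_def parcs_graph_disjoint_union_iff)

text \<open>
  The shape of the graph in the odd case: \<open>X\<close> and \<open>Y\<close> are the two cliques without edges between
  them, and \<open>D\<close> is the clique of vertices adjacent to everything.
\<close>

lemma digraph_iso_join_completeI:
  assumes fin: "finite (pverts G)"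
    and part: "pverts G = D \<union> X \<union> Y" "D \<inter> X = {}" "D \<inter> Y = {}" "X \<inter> Y = {}"
    and arcs: "parcs G = {(u, v). u \<in> pverts G \<and> v \<in> pverts G \<and> u \<noteq> v \<and>
      \<not> (u \<in> X \<and> v \<in> Y) \<and> \<not> (u \<in> Y \<and> v \<in> X)}"
  shows "digraph_iso (with_proj G)
    (with_proj (graph_join (complete_graph (card D))
      (graph_disjoint_union (complete_graph (card X)) (complete_graph (card Y)))))"
    (is "digraph_iso _ (with_proj ?H)")
proof -
  have "\<exists>f. bij_betw f S {..<card S}" if "S \<subseteq> pverts G" for S
    using ex_bij_betw_finite_nat[OF finite_subset[OF that fin]] by (auto simp: atLeast0LessThan)
  then obtain d x y where d: "bij_betw d D {..<card D}" and x: "bij_betw x X {..<card X}"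
    and y: "bij_betw y Y {..<card Y}"
    using part(1) by (metis Un_upper1 Un_upper2 le_supI1)
  define f where "f v = (if v \<in> D then Inl (d v) else if v \<in> X then Inr (Inl (x v))
    else Inr (Inr (y v)))" for v
  have fD: "f v = Inl (d v)" if "v \<in> D" for v
    using that by (simp add: f_def)
  have fX: "f v = Inr (Inl (x v))" if "v \<in> X" for v
    using that part by (auto simp: f_def)
  have fY: "f v = Inr (Inr (y v))" if "v \<in> Y" for v
    using that part by (auto simp: f_def)
  have injD: "d u = d v \<longleftrightarrow> u = v" if "u \<in> D" "v \<in> D" for u v
    using that d by (meson bij_betw_imp_inj_on inj_on_eq_iff)
  have injX: "x u = x v \<longleftrightarrow> u = v" if "u \<in> X" "v \<in> X" for u v
    using that x by (meson bij_betw_imp_inj_on inj_on_eq_iff)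
  have injY: "y u = y v \<longleftrightarrow> u = v" if "u \<in> Y" "v \<in> Y" for u v
    using that y by (meson bij_betw_imp_inj_on inj_on_eq_iff)
  have less: "v \<in> D \<Longrightarrow> d v < card D" "v \<in> X \<Longrightarrow> x v < card X" "v \<in> Y \<Longrightarrow> y v < card Y" for v
    using d x y by (auto dest: bij_betwE)
  have "f ` D = Inl ` d ` D" "f ` X = Inr ` Inl ` x ` X" "f ` Y = Inr ` Inr ` y ` Y"
    by (simp_all add: fD fX fY image_image)
  then have "f ` D = Inl ` {..<card D}" "f ` X = Inr ` Inl ` {..<card X}"
    "f ` Y = Inr ` Inr ` {..<card Y}"
    using d x y by (simp_all add: bij_betw_def)
  then have im: "f ` pverts G = pverts ?H"
    by (auto simp: part(1) image_Un graph_join_def graph_disjoint_union_def complete_graph_def Plus_def)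
  have "inj_on f (pverts G)"
    by (rule inj_onI) (auto simp: part(1) fD fX fY injD injX injY)
  then have bij: "bij_betw f (pverts G) (pverts ?H)"
    using im by (simp add: bij_betw_def)
  have H: "parcs ?H \<subseteq> pverts ?H \<times> pverts ?H"
    by (auto simp: graph_join_def graph_disjoint_union_def complete_graph_def)
  show ?thesis
  proof (rule digraph_iso_with_projI[OF bij _ H])
    show "parcs G \<subseteq> pverts G \<times> pverts G"
      using arcs by auto
    fix u v assume uv: "u \<in> pverts G" "v \<in> pverts G"
    note H_arcs = parcs_graph_join_iff parcs_graph_disjoint_union_iff parcs_complete_graph_iff
    have verts: "pverts (complete_graph r) = {..<r}"
      "Inl i \<in> pverts (graph_disjoint_union K L) \<longleftrightarrow> i \<in> pverts K"
      "Inr j \<in> pverts (graph_disjoint_union K L) \<longleftrightarrow> j \<in> pverts L"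
      for r i j and K :: "nat pair_pre_digraph" and L :: "nat pair_pre_digraph"
      by (auto simp: complete_graph_def graph_disjoint_union_def)
    have arc: "(u, v) \<in> parcs G \<longleftrightarrow> u \<noteq> v \<and> \<not> (u \<in> X \<and> v \<in> Y) \<and> \<not> (u \<in> Y \<and> v \<in> X)"
      using uv by (simp add: arcs)
    have "u \<in> D \<and> u \<notin> X \<and> u \<notin> Y \<or> u \<in> X \<and> u \<notin> D \<and> u \<notin> Y \<or> u \<in> Y \<and> u \<notin> D \<and> u \<notin> X"
      "v \<in> D \<and> v \<notin> X \<and> v \<notin> Y \<or> v \<in> X \<and> v \<notin> D \<and> v \<notin> Y \<or> v \<in> Y \<and> v \<notin> D \<and> v \<notin> X"
      using uv part by blast+
    then show "(f u, f v) \<in> parcs ?H \<longleftrightarrow> (u, v) \<in> parcs G"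
      unfolding arc
      by (elim disjE conjE) (auto simp: fD fX fY injD injX injY less H_arcs verts)
  qed
qed

section \<open>The order super commuting relation\<close>

lemma ord_hom_inj:
  assumes "group_hom G H f" "inj_on f (carrier G)" "x \<in> carrier G"
  shows "group.ord H (f x) = group.ord G x"
proof -
  interpret group_hom G H f by fact
  have "f x [^]\<^bsub>H\<^esub> k = \<one>\<^bsub>H\<^esub> \<longleftrightarrow> x [^]\<^bsub>G\<^esub> k = \<one>\<^bsub>G\<^esub>" for k :: nat
    using assms(2,3) by (metis G.nat_pow_closed G.one_closed hom_nat_pow hom_one inj_onD)
  then show ?thesis
    using assms(3) by (simp add: H.ord_unique G.pow_eq_id)
qed

text \<open>
  Adjacency in the order super commuting graph without the requirement that the vertices differ;
  in this form it depends only on the orders of the two elements.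
\<close>

definition os_commute :: "('g, 'm) monoid_scheme \<Rightarrow> 'g \<Rightarrow> 'g \<Rightarrow> bool" where
  "os_commute G g h \<longleftrightarrow> group.ord G g = group.ord G h \<or>
    (\<exists>g'\<in>carrier G. \<exists>h'\<in>carrier G. group.ord G g' = group.ord G g \<and>
      group.ord G h' = group.ord G h \<and> g' \<otimes>\<^bsub>G\<^esub> h' = h' \<otimes>\<^bsub>G\<^esub> g')"

lemma parcs_OSCom:
  "parcs (OSCom G) = {(g, h). g \<in> carrier G \<and> h \<in> carrier G \<and> g \<noteq> h \<and> os_commute G g h}"
  by (simp add: OSCom_def os_commute_def)

lemma pverts_OSCom: "pverts (OSCom G) = carrier G"
  by (simp add: OSCom_def)

lemma os_commute_sym: "os_commute G g h \<longleftrightarrow> os_commute G h g"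
  unfolding os_commute_def by metis

lemma os_commuteI:
  assumes "g' \<in> carrier G" "h' \<in> carrier G"
    "group.ord G g' = group.ord G g" "group.ord G h' = group.ord G h"
    "g' \<otimes>\<^bsub>G\<^esub> h' = h' \<otimes>\<^bsub>G\<^esub> g'"
  shows "os_commute G g h"
  using assms unfolding os_commute_def by blast

text \<open>
  An injective homomorphism preserves orders and both preserves and reflects commutation, and
  bijectivity lets the witnesses be moved in either direction.
\<close>

lemma OSCom_iso:
  assumes "group G" "group H" "f \<in> iso G H"
  shows "digraph_iso (with_proj (OSCom G)) (with_proj (OSCom H))"
proof -
  have hom: "group_hom G H f"
    using assms by (auto simp: group_hom_def group_hom_axioms_def iso_def)
  interpret group_hom G H f by (rule hom)
  have bij: "bij_betw f (carrier G) (carrier H)"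
    using assms(3) by (simp add: iso_def)
  have inj: "inj_on f (carrier G)" and im: "carrier H = f ` carrier G"
    using bij by (auto simp: bij_betw_def)
  have "f x \<otimes>\<^bsub>H\<^esub> f y = f y \<otimes>\<^bsub>H\<^esub> f x \<longleftrightarrow> x \<otimes>\<^bsub>G\<^esub> y = y \<otimes>\<^bsub>G\<^esub> x"
    if "x \<in> carrier G" "y \<in> carrier G" for x y
    using that inj by (metis G.m_closed hom_mult inj_onD)
  then have "os_commute H (f u) (f v) \<longleftrightarrow> os_commute G u v"
    if "u \<in> carrier G" "v \<in> carrier G" for u v
    using that unfolding os_commute_def im
    by (simp add: ord_hom_inj[OF hom inj] del: hom_mult cong: bex_cong conj_cong)
  then show ?thesis
    using bij inj
    by (intro digraph_iso_with_projI[of f])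
      (auto simp: parcs_OSCom pverts_OSCom dest: inj_onD)
qed

section \<open>A concrete model of the group\<close>

text \<open>
  The pair \<open>(i, s)\<close> stands for \<open>a\<^sup>i b\<^sup>s\<close>. Moving an odd power of \<open>b\<close> past \<open>a\<^sup>j\<close> turns it into \<open>a\<^sup>-\<^sup>j\<close>
  and leaves a factor \<open>b\<^bsup>-2j\<^esup>\<close>. On unreduced integer pairs this is already exactly associative.
  Reduction to representatives is therefore kept separate: associativity of the model follows
  from that on integer pairs by \<open>V_red_mult_cong\<close>.
\<close>

definition V_mult :: "int \<times> int \<Rightarrow> int \<times> int \<Rightarrow> int \<times> int" where
  "V_mult x y = (if even (snd x) then (fst x + fst y, snd x + snd y)
    else (fst x - fst y, snd x - 2 * fst y + snd y))"

definition V_red :: "nat \<Rightarrow> int \<times> int \<Rightarrow> int \<times> int" where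
  "V_red n x = (fst x mod (2 * int n), snd x mod 4)"

definition V_model :: "nat \<Rightarrow> (int \<times> int) monoid" where
  "V_model n = \<lparr>carrier = {0..<2 * int n} \<times> {0..<4},
    monoid.mult = (\<lambda>x y. V_red n (V_mult x y)), monoid.one = (0, 0)\<rparr>"

lemma V_mult_assoc: "V_mult (V_mult x y) z = V_mult x (V_mult y z)"
  by (simp add: V_mult_def)

lemma V_red_eq_iff:
  "V_red n x = V_red n y \<longleftrightarrow> 2 * int n dvd fst x - fst y \<and> 4 dvd snd x - snd y"
  by (simp add: V_red_def mod_eq_dvd_iff)

text \<open>
  Reduction is compatible with multiplication: parity of \<open>s\<close> survives modulo \<open>4\<close>, and changing
  \<open>j\<close> by a multiple of \<open>2n\<close> changes the correction \<open>- 2 * j\<close> by a multiple of \<open>4\<close>.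
\<close>

lemma V_red_mult_cong:
  assumes "V_red n x = V_red n x'" "V_red n y = V_red n y'"
  shows "V_red n (V_mult x y) = V_red n (V_mult x' y')"
proof -
  obtain k l k' l' where x: "fst x = fst x' + 2 * int n * k" "snd x = snd x' + 4 * l"
    and y: "fst y = fst y' + 2 * int n * k'" "snd y = snd y' + 4 * l'"
    using assms unfolding V_red_eq_iff dvd_def by (metis add.commute diff_add_cancel)
  show ?thesis
  proof (cases "even (snd x')")
    case True
    then have "V_mult x y =
      (fst (V_mult x' y') + 2 * int n * (k + k'), snd (V_mult x' y') + 4 * (l + l'))"
      by (simp add: V_mult_def x y algebra_simps)
    then show ?thesis by (simp add: V_red_eq_iff)
  next
    case False
    then have "V_mult x y =
      (fst (V_mult x' y') + 2 * int n * (k - k'), snd (V_mult x' y') + 4 * (l + l' - int n * k'))"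
      by (simp add: V_mult_def x y algebra_simps)
    then show ?thesis by (simp add: V_red_eq_iff)
  qed
qed

lemma V_red_red: "V_red n (V_red n x) = V_red n x"
  by (simp add: V_red_def)

lemma V_red_id: "x \<in> carrier (V_model n) \<Longrightarrow> V_red n x = x"
  by (auto simp: V_model_def V_red_def)

lemma V_red_closed: "n \<ge> 1 \<Longrightarrow> V_red n x \<in> carrier (V_model n)"
  by (simp add: V_model_def V_red_def)

lemma mult_V_model: "x \<otimes>\<^bsub>V_model n\<^esub> y = V_red n (V_mult x y)"
  by (simp add: V_model_def)

lemma one_V_model: "\<one>\<^bsub>V_model n\<^esub> = (0, 0)"
  by (simp add: V_model_def)

lemma group_V_model:
  assumes "n \<ge> 1"
  shows "group (V_model n)"
proof (rule groupI)
  fix x y z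
  show "x \<otimes>\<^bsub>V_model n\<^esub> y \<otimes>\<^bsub>V_model n\<^esub> z = x \<otimes>\<^bsub>V_model n\<^esub> (y \<otimes>\<^bsub>V_model n\<^esub> z)"
    unfolding mult_V_model
    using V_red_mult_cong[OF V_red_red HOL.refl] V_red_mult_cong[OF HOL.refl V_red_red]
    by (metis V_mult_assoc)
next
  fix x assume x: "x \<in> carrier (V_model n)"
  \<comment> \<open>The squares outside \<open>A\<close> are powers of \<open>b\<^sup>2\<close>, so there the inverse keeps the exponent of \<open>a\<close>.\<close>
  let ?y = "if even (snd x) then (- fst x, - snd x) else (fst x, 2 * fst x - snd x)"
  have "V_red n ?y \<otimes>\<^bsub>V_model n\<^esub> x = V_red n (V_mult ?y x)"
    unfolding mult_V_model by (rule V_red_mult_cong[OF V_red_red HOL.refl])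
  also have "\<dots> = \<one>\<^bsub>V_model n\<^esub>"
    by (simp add: V_mult_def V_red_def one_V_model)
  finally show "\<exists>y\<in>carrier (V_model n). y \<otimes>\<^bsub>V_model n\<^esub> x = \<one>\<^bsub>V_model n\<^esub>"
    using V_red_closed[OF assms] by blast
next
  fix x assume x: "x \<in> carrier (V_model n)"
  have "V_mult (0, 0) x = x"
    by (simp add: V_mult_def)
  then show "\<one>\<^bsub>V_model n\<^esub> \<otimes>\<^bsub>V_model n\<^esub> x = x"
    using V_red_id[OF x] by (simp add: one_V_model mult_V_model)
qed (use assms V_red_closed[OF assms] in \<open>auto simp: mult_V_model one_V_model\<close>, simp add: V_model_def)

section \<open>The presented group is the model\<close>

text \<open>Conjugation by \<open>g\<close> is a homomorphism, so it maps powers to powers.\<close>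

lemma (in group) int_pow_conj:
  assumes "g \<in> carrier G" "x \<in> carrier G" "y \<in> carrier G" "g \<otimes> x = y \<otimes> g"
  shows "g \<otimes> x [^] (i :: int) = y [^] i \<otimes> g"
proof -
  have "(\<lambda>t. g \<otimes> t \<otimes> inv g) \<in> hom G G"
  proof (rule homI)
    fix s t assume "s \<in> carrier G" "t \<in> carrier G"
    then show "g \<otimes> (s \<otimes> t) \<otimes> inv g = g \<otimes> s \<otimes> inv g \<otimes> (g \<otimes> t \<otimes> inv g)"
      using assms(1) by (simp add: m_assoc inv_solve_left)
  qed (use assms(1) in simp)
  then have "g \<otimes> x [^] i \<otimes> inv g = (g \<otimes> x \<otimes> inv g) [^] i"
    using hom_int_pow[OF _ assms(2) is_group is_group] by blast
  moreover have "g \<otimes> x \<otimes> inv g = y"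
    using assms by (simp add: inv_solve_right')
  ultimately have "g \<otimes> x [^] i \<otimes> inv g = y [^] i"
    by simp
  then show ?thesis
    using assms by (metis int_pow_closed inv_solve_right m_closed)
qed

text \<open>
  In every group the relations force the normal forms to multiply by \<open>V_mult\<close>. Two consequences
  of the relations carry the computation: \<open>b\<^sup>2\<close> commutes with \<open>a\<close>, and \<open>b a b\<^sup>-\<^sup>1 = a\<^sup>-\<^sup>1 b\<^sup>-\<^sup>2\<close>.
\<close>

lemma (in group) V_normal_form_mult:
  assumes ab: "a \<in> carrier G" "b \<in> carrier G"
    and b4: "b [^] (4 :: int) = \<one>"
    and ba: "b \<otimes> a = inv a \<otimes> inv b" and b'a: "inv b \<otimes> a = inv a \<otimes> b"
  shows "(a [^] fst x \<otimes> b [^] snd x) \<otimes> (a [^] fst y \<otimes> b [^] snd y) =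
    a [^] fst (V_mult x y) \<otimes> b [^] snd (V_mult x y)"
proof -
  let ?z = "b [^] (2 :: int)"
  have z: "b \<otimes> b = ?z"
    using int_pow_mult[OF ab(2), of 1 1] ab by simp
  have z': "inv b \<otimes> inv b = ?z"
  proof -
    have "?z \<otimes> ?z = \<one>"
      using int_pow_mult[OF ab(2), of 2 2] b4 by simp
    then have "inv ?z = ?z"
      using ab by (simp add: inv_equality)
    then show ?thesis
      using ab by (simp add: inv_mult_group flip: z)
  qed
  have "a \<otimes> inv b = b \<otimes> inv a"
  proof -
    have "a = b \<otimes> (inv b \<otimes> a)"
      using ab by (simp flip: m_assoc)
    also have "\<dots> = b \<otimes> inv a \<otimes> b"
      using ab by (simp add: b'a m_assoc)
    finally show ?thesis
      using ab by (metis inv_closed inv_solve_right' m_closed)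
  qed
  \<comment> \<open>\<open>b b a = b a\<^sup>-\<^sup>1 b\<^sup>-\<^sup>1 = a b\<^sup>-\<^sup>1 b\<^sup>-\<^sup>1 = a b b\<close>\<close>
  then have za: "?z \<otimes> a = a \<otimes> ?z"
    using ab by (metis ba inv_closed m_assoc z z')
  have aiz: "a [^] i \<otimes> ?z = ?z \<otimes> a [^] i" for i :: int
    using int_pow_conj[of ?z a a i] za ab by simp
  have aiz': "a [^] i \<otimes> b [^] (2 * k) = b [^] (2 * k) \<otimes> a [^] i" for i k :: int
    using int_pow_conj[of "a [^] i" ?z ?z k] aiz[of i] ab by (simp add: int_pow_pow)
  have "b \<otimes> a = inv a \<otimes> b [^] (- 2 :: int) \<otimes> b"
    using int_pow_mult[OF ab(2), of "- 2" 1] ab by (simp add: ba m_assoc int_pow_neg)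
  moreover have comm: "inv a \<otimes> b [^] (- 2 :: int) = b [^] (- 2 :: int) \<otimes> inv a"
    using aiz'[of "-1" "-1"] ab by (simp add: int_pow_neg)
  ultimately have "b \<otimes> a [^] i = (inv a \<otimes> b [^] (- 2 :: int)) [^] i \<otimes> b" for i :: int
    using int_pow_conj[of b a "inv a \<otimes> b [^] (- 2 :: int)" i] ab by blast
  then have "b \<otimes> a [^] i = inv a [^] i \<otimes> (b [^] (- 2 :: int)) [^] i \<otimes> b" for i :: int
    using ab by (simp only: int_pow_mult_distrib[OF comm] inv_closed int_pow_closed)
  then have bai: "b \<otimes> a [^] i = a [^] (- i) \<otimes> b [^] (1 - 2 * i)" for i :: int
    using int_pow_mult[OF ab(2), of "- 2 * i" 1] ab
    by (simp add: int_pow_inv int_pow_neg[OF ab(1)] int_pow_pow m_assoc)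
  have odd: "b [^] (2 * k + 1) \<otimes> a [^] i = a [^] (- i) \<otimes> b [^] (2 * k + 1 - 2 * i)" for i k :: int
  proof -
    have "b [^] (2 * k + 1) \<otimes> a [^] i = b [^] (2 * k) \<otimes> (b \<otimes> a [^] i)"
      using ab by (simp add: int_pow_mult m_assoc)
    also have "\<dots> = a [^] (- i) \<otimes> (b [^] (2 * k) \<otimes> b [^] (1 - 2 * i))"
      using ab by (simp add: bai aiz' flip: m_assoc)
    finally show ?thesis
      using ab by (simp add: algebra_simps flip: int_pow_mult)
  qed
  show ?thesis
  proof (cases "even (snd x)")
    case True
    then obtain k where k: "snd x = 2 * k" by blast
    have "(a [^] fst x \<otimes> b [^] snd x) \<otimes> (a [^] fst y \<otimes> b [^] snd y) =
      a [^] fst x \<otimes> (b [^] (2 * k) \<otimes> a [^] fst y) \<otimes> b [^] snd y"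
      using ab by (simp add: k m_assoc)
    then show ?thesis
      using ab True by (simp add: V_mult_def k m_assoc int_pow_mult flip: aiz')
  next
    case False
    then obtain k where k: "snd x = 2 * k + 1" using oddE by blast
    have "(a [^] fst x \<otimes> b [^] snd x) \<otimes> (a [^] fst y \<otimes> b [^] snd y) =
      a [^] fst x \<otimes> (b [^] (2 * k + 1) \<otimes> a [^] fst y) \<otimes> b [^] snd y"
      using ab by (simp add: k m_assoc)
    also have "\<dots> = (a [^] fst x \<otimes> a [^] (- fst y)) \<otimes> (b [^] (2 * k + 1 - 2 * fst y) \<otimes> b [^] snd y)"
      using ab by (simp add: odd m_assoc)
    finally show ?thesis
      using ab False by (simp add: V_mult_def k flip: int_pow_mult)
  qed
qed

lemma (in group) int_pow_mod:
  assumes "x \<in> carrier G" "x [^] m = \<one>"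
  shows "x [^] (i mod m) = x [^] (i :: int)"
proof -
  have "x [^] i = x [^] (m * (i div m) + i mod m)"
    by simp
  also have "\<dots> = (x [^] m) [^] (i div m) \<otimes> x [^] (i mod m)"
    using assms(1) by (simp only: int_pow_mult int_pow_pow)
  finally show ?thesis
    using assms by simp
qed

lemma word_class_closed: "word_cong R `` {w} \<in> carrier (presented_group R)"
  by (auto simp: carrier_presented_group)

lemma word_class_pow:
  "word_cong R `` {word_pow w k} = word_cong R `` {w} [^]\<^bsub>presented_group R\<^esub> k"
proof -
  interpret P: group "presented_group R" by (rule group_presented_group)
  show ?thesis
  proof (induction k)
    case 0
    show ?case by (simp add: word_pow_def one_presented_group)
  next
    case (Suc k)
    have "word_pow w (Suc k) = w @ word_pow w k"
      by (simp add: word_pow_def)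
    then show ?case
      using Suc by (simp add: P.nat_pow_Suc2 word_class_closed del: P.nat_pow_Suc nat_pow_Suc flip: mult_presented_group)
  qed
qed

lemma word_class_inv:
  "word_cong R `` {word_inv w} = inv\<^bsub>presented_group R\<^esub> (word_cong R `` {w})"
proof -
  interpret P: group "presented_group R" by (rule group_presented_group)
  show ?thesis
    by (rule P.inv_equality[symmetric])
      (simp_all add: word_class_closed mult_presented_group one_presented_group
        word_cong_class_eq_iff word_inv_left)
qed

lemma word_eval_pow:
  assumes "group H" "\<And>x. f x \<in> carrier H"
  shows "word_eval H f (word_pow w k) = word_eval H f w [^]\<^bsub>H\<^esub> k"
proof -
  interpret H: group H by fact
  show ?thesis
  proof (induction k)
    case 0
    show ?case by (simp add: word_pow_def)
  next
    case (Suc k)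
    have "word_pow w (Suc k) = w @ word_pow w k"
      by (simp add: word_pow_def)
    then show ?case
      using Suc by (simp add: word_eval_append[OF assms] H.nat_pow_Suc2 word_eval_closed[OF assms] del: H.nat_pow_Suc nat_pow_Suc)
  qed
qed

lemma V_model_pow_a: "n \<ge> 1 \<Longrightarrow> (1, 0) [^]\<^bsub>V_model n\<^esub> k = V_red n (int k, 0)"
  by (induction k)
    (simp_all add: one_V_model mult_V_model V_mult_def V_red_def mod_simps add.commute)

lemma V_model_pow_b: "n \<ge> 1 \<Longrightarrow> (0, 1) [^]\<^bsub>V_model n\<^esub> k = V_red n (0, int k)"
  by (induction k)
    (simp_all add: one_V_model mult_V_model V_mult_def V_red_def mod_simps add.commute)

definition V_gens :: "V_gen \<Rightarrow> int \<times> int" where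
  "V_gens x = (case x of Gen_a \<Rightarrow> (1, 0) | Gen_b \<Rightarrow> (0, 1))"

definition V_rels :: "nat \<Rightarrow> (V_gen word \<times> V_gen word) set" where
  "V_rels n = {(word_pow (gen Gen_a) (2 * n), []), (word_pow (gen Gen_b) 4, []),
    (gen Gen_b @ gen Gen_a, word_inv (gen Gen_a) @ word_inv (gen Gen_b)),
    (word_inv (gen Gen_b) @ gen Gen_a, word_inv (gen Gen_a) @ gen Gen_b)}"

lemma V8n_eq: "V8n n = presented_group (V_rels n)"
  by (simp add: V8n_def V_rels_def Let_def)

lemma V_gens_rels:
  assumes n: "n \<ge> 1" and uv: "(u, v) \<in> V_rels n"
  shows "word_eval (V_model n) V_gens u = word_eval (V_model n) V_gens v"
proof -
  interpret M: group "V_model n" by (rule group_V_model[OF n])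
  have car: "V_gens x \<in> carrier (V_model n)" for x
    using n by (cases x) (auto simp: V_gens_def V_model_def)
  have inv: "inv\<^bsub>V_model n\<^esub> (1, 0) = V_red n (-1, 0)" "inv\<^bsub>V_model n\<^esub> (0, 1) = V_red n (0, -1)"
    using car[of Gen_a] car[of Gen_b]
    by (auto intro!: M.inv_equality V_red_closed[OF n] simp: V_gens_def)
      (simp_all add: mult_V_model one_V_model V_mult_def V_red_def mod_simps)
  note ev = word_eval_append[OF M.is_group car]
  have ga: "word_eval (V_model n) V_gens (gen Gen_a) = (1, 0)"
    and gb: "word_eval (V_model n) V_gens (gen Gen_b) = (0, 1)"
    using car[of Gen_a] car[of Gen_b] by (simp_all add: gen_def V_gens_def)
  have ia: "word_eval (V_model n) V_gens (word_inv (gen Gen_a)) = V_red n (-1, 0)"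
    and ib: "word_eval (V_model n) V_gens (word_inv (gen Gen_b)) = V_red n (0, -1)"
    using V_red_closed[OF n] by (simp_all add: gen_def word_inv_def V_gens_def inv)
  show ?thesis
    using uv n unfolding V_rels_def
    by (auto simp: ev ga gb ia ib word_eval_pow[OF M.is_group car] V_model_pow_a V_model_pow_b
       mult_V_model one_V_model V_red_def V_mult_def mod_simps)
qed

text \<open>
  The model satisfies the relations, so the universal property gives a homomorphism \<open>h\<close> to it.
  Evaluation of normal forms is a homomorphism back, and the composite on the presented group
  fixes the generators, hence is the identity by uniqueness. This gives injectivity of \<open>h\<close> without
  rewriting words to normal form.
\<close>

theorem V8n_iso_V_model:
  assumes n: "n \<ge> 1"
  shows "\<exists>h. h \<in> iso (V8n n) (V_model n)"
proof -
  let ?P = "presented_group (V_rels n)" and ?M = "V_model n"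
  interpret P: group ?P by (rule group_presented_group)
  interpret M: group ?M by (rule group_V_model[OF n])
  define cl where "cl w = word_cong (V_rels n) `` {w}" for w
  have cl: "cl w \<in> carrier ?P" for w
    by (simp add: cl_def word_class_closed)
  have gens: "V_gens x \<in> carrier ?M" for x
    using n by (cases x) (auto simp: V_gens_def V_model_def)
  obtain h where h: "h \<in> hom ?P ?M" "\<And>w. h (cl w) = word_eval ?M V_gens w"
    using presented_group_universal[OF M.is_group gens V_gens_rels[OF n]] unfolding cl_def by blast
  have hgen: "h (cl (gen x)) = V_gens x" for x
    using gens[of x] by (simp add: h(2) gen_def)
  define a b where "a = cl (gen Gen_a)" and "b = cl (gen Gen_b)"
  have ab: "a \<in> carrier ?P" "b \<in> carrier ?P"
    by (simp_all add: a_def b_def cl)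
  have rel: "cl u = cl v" if "(u, v) \<in> V_rels n" for u v
    using that unfolding cl_def word_cong_class_eq_iff by (rule word_cong.relation)
  have clm: "cl (u @ v) = cl u \<otimes>\<^bsub>?P\<^esub> cl v" for u v
    by (simp add: cl_def mult_presented_group)
  have cli: "cl (word_inv u) = inv\<^bsub>?P\<^esub> cl u" for u
    by (simp add: cl_def word_class_inv)
  have clp: "cl (word_pow u k) = cl u [^]\<^bsub>?P\<^esub> k" for u k
    by (simp add: cl_def word_class_pow)
  have cl1: "cl [] = \<one>\<^bsub>?P\<^esub>"
    by (simp add: cl_def one_presented_group)
  have "a [^]\<^bsub>?P\<^esub> (2 * n) = \<one>\<^bsub>?P\<^esub>" "b [^]\<^bsub>?P\<^esub> (4 :: nat) = \<one>\<^bsub>?P\<^esub>"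
    unfolding a_def b_def cl1[symmetric] clp[symmetric] by (rule rel; simp add: V_rels_def)+
  then have pow: "a [^]\<^bsub>?P\<^esub> (2 * int n) = \<one>\<^bsub>?P\<^esub>" "b [^]\<^bsub>?P\<^esub> (4 :: int) = \<one>\<^bsub>?P\<^esub>"
    using int_pow_int[of ?P a "2 * n"] int_pow_int[of ?P b 4] by simp_all
  have ba: "b \<otimes>\<^bsub>?P\<^esub> a = inv\<^bsub>?P\<^esub> a \<otimes>\<^bsub>?P\<^esub> inv\<^bsub>?P\<^esub> b"
    "inv\<^bsub>?P\<^esub> b \<otimes>\<^bsub>?P\<^esub> a = inv\<^bsub>?P\<^esub> a \<otimes>\<^bsub>?P\<^esub> b"
    unfolding a_def b_def clm[symmetric] cli[symmetric] by (rule rel; simp add: V_rels_def)+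
  define nf where "nf x = a [^]\<^bsub>?P\<^esub> fst x \<otimes>\<^bsub>?P\<^esub> b [^]\<^bsub>?P\<^esub> snd x" for x :: "int \<times> int"
  have nf_red: "nf (V_red n x) = nf x" for x
    using ab pow by (simp add: nf_def V_red_def P.int_pow_mod)
  have nf_closed: "nf x \<in> carrier ?P" for x
    using ab by (simp add: nf_def)
  have nf: "nf \<in> hom ?M ?P"
    by (rule homI)
      (simp_all add: nf_closed mult_V_model nf_red,
       simp add: nf_def P.V_normal_form_mult[OF ab pow(2) ba])
  have "(nf \<circ> h) (cl (gen x)) = cl (gen x)" for x
    using ab by (cases x) (simp_all add: hgen V_gens_def nf_def a_def b_def)
  then have "(nf \<circ> h) X = (\<lambda>x. x) X" if "X \<in> carrier ?P" for X
    using presented_group_hom_unique[OF P.is_group Group.hom_compose[OF h(1) nf] _ _ that, of "\<lambda>x. x"]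
    by (auto simp: cl_def hom_def)
  then have left: "nf (h X) = X" if "X \<in> carrier ?P" for X
    using that by simp
  have right: "h (nf x) = x" if x: "x \<in> carrier ?M" for x
  proof -
    obtain i s where ij: "x = (int i, int s)"
      using x by (cases x) (auto simp: V_model_def elim!: nonneg_int_cases)
    interpret h: group_hom ?P ?M h
      using h(1) by unfold_locales
    have "h (nf x) = h a [^]\<^bsub>?M\<^esub> i \<otimes>\<^bsub>?M\<^esub> h b [^]\<^bsub>?M\<^esub> s"
      using ab by (simp add: nf_def ij int_pow_int h.hom_nat_pow)
    also have "\<dots> = V_red n (V_mult (V_red n (int i, 0)) (V_red n (0, int s)))"
      using n unfolding a_def b_def hgen
      by (simp add: V_gens_def V_model_pow_a V_model_pow_b mult_V_model)
    also have "\<dots> = V_red n (V_mult (int i, 0) (0, int s))"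
      by (rule V_red_mult_cong[OF V_red_red V_red_red])
    also have "\<dots> = x"
      using V_red_id[OF x] by (simp add: ij V_mult_def)
    finally show ?thesis .
  qed
  have "bij_betw h (carrier ?P) (carrier ?M)"
    by (rule bij_betw_byWitness[of _ nf])
      (use left right nf_closed hom_in_carrier[OF h(1)] in auto)
  then show ?thesis
    using h(1) by (auto simp: V8n_eq iso_def)
qed

section \<open>Orders and commuting elements\<close>

lemma V_model_square:
  "x \<otimes>\<^bsub>V_model n\<^esub> x =
    V_red n (if even (snd x) then (2 * fst x, 0) else (0, 2 * (snd x - fst x)))"
proof (cases "even (snd x)")
  case True
  then have "(snd x + snd x) mod 4 = 0"
    by presburger
  then show ?thesis
    using True by (simp add: mult_V_model V_mult_def V_red_def)
next
  case False
  then show ?thesis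
    by (simp add: mult_V_model V_mult_def algebra_simps)
qed

lemma V_model_ord_dvd_2:
  assumes n: "n \<ge> 1" and x: "x \<in> carrier (V_model n)"
  shows "group.ord (V_model n) x dvd 2 \<longleftrightarrow>
    (if even (snd x) then int n dvd fst x else odd (fst x))"
proof -
  interpret M: group "V_model n" by (rule group_V_model[OF n])
  have "M.ord x dvd 2 \<longleftrightarrow> x \<otimes>\<^bsub>V_model n\<^esub> x = \<one>\<^bsub>V_model n\<^esub>"
    using x by (simp add: numeral_2_eq_2 flip: M.pow_eq_id)
  moreover have "(2 * (snd x - fst x)) mod 4 = 0 \<longleftrightarrow> odd (fst x)" if "odd (snd x)"
    using that by presburger
  ultimately show ?thesis
    by (simp add: V_model_square V_red_def one_V_model flip: dvd_eq_mod_eq_0)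
qed

lemma V_model_ord_dvd_4:
  assumes n: "n \<ge> 1" and x: "x \<in> carrier (V_model n)"
  shows "group.ord (V_model n) x dvd 4 \<longleftrightarrow> (even (snd x) \<longrightarrow> int n dvd 2 * fst x)"
proof -
  interpret M: group "V_model n" by (rule group_V_model[OF n])
  define w where "w = (if even (snd x) then (2 * fst x, 0) else (0, 2 * (snd x - fst x)))"
  have "M.ord x dvd 4 \<longleftrightarrow> (x \<otimes>\<^bsub>V_model n\<^esub> x) \<otimes>\<^bsub>V_model n\<^esub> (x \<otimes>\<^bsub>V_model n\<^esub> x) = \<one>\<^bsub>V_model n\<^esub>"
    using x by (simp add: numeral_eq_Suc M.m_assoc flip: M.pow_eq_id)
  also have "x \<otimes>\<^bsub>V_model n\<^esub> x = V_red n w"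
    unfolding V_model_square w_def by (rule HOL.refl)
  also have "V_red n w \<otimes>\<^bsub>V_model n\<^esub> V_red n w = V_red n (V_mult w w)"
    unfolding mult_V_model by (rule V_red_mult_cong[OF V_red_red V_red_red])
  also have "V_red n (V_mult w w) = \<one>\<^bsub>V_model n\<^esub> \<longleftrightarrow> (even (snd x) \<longrightarrow> int n dvd 2 * fst x)"
  proof -
    have "2 * int n dvd 4 * fst x \<longleftrightarrow> int n dvd 2 * fst x"
      using dvd_mult_cancel_left[of 2 "int n" "2 * fst x"] by simp
    then show ?thesis
      by (auto simp: w_def V_mult_def V_red_def one_V_model simp flip: dvd_eq_mod_eq_0)
  qed
  finally show ?thesis .
qed

lemma dvd_4_cases:
  assumes "d dvd (4 :: nat)"
  obtains "d = 1" | "d = 2" | "d = 4"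
proof -
  have "d \<le> 4" using assms by (rule dvd_imp_le) simp
  then have "d = 0 \<or> d = 1 \<or> d = 2 \<or> d = 3 \<or> d = 4" by arith
  then show ?thesis using assms that by auto
qed

lemma dvd_2_cases:
  assumes "d dvd (2 :: nat)"
  obtains "d = 1" | "d = 2"
  using dvd_trans[OF assms, of 4] assms by (auto elim: dvd_4_cases)

lemma V_model_commute_even:
  assumes "even (snd x)" "even (snd y)"
  shows "x \<otimes>\<^bsub>V_model n\<^esub> y = y \<otimes>\<^bsub>V_model n\<^esub> x"
  using assms by (simp add: mult_V_model V_mult_def add.commute)

text \<open>
  Conjugation by an element outside \<open>A\<close> inverts \<open>a\<^sup>j\<close> up to a power of \<open>b\<^sup>2\<close>, so an element of \<open>A\<close>
  that is fixed by it has \<open>a\<^bsup>2j\<^esup> = 1\<close> by uniqueness of normal forms.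
\<close>

lemma V_model_commute_odd:
  assumes n: "n \<ge> 1" and y: "y \<in> carrier (V_model n)" "even (snd y)" and x: "odd (snd x)"
    and "x \<otimes>\<^bsub>V_model n\<^esub> y = y \<otimes>\<^bsub>V_model n\<^esub> x"
  shows "group.ord (V_model n) y dvd 2"
proof -
  have "2 * int n dvd - 2 * fst y"
    using assms(5) x y(2) by (simp add: mult_V_model V_mult_def V_red_eq_iff)
  then have "int n dvd fst y"
    by simp
  then show ?thesis
    using V_model_ord_dvd_2[OF n y(1)] y(2) by simp
qed

text \<open>
  The orders \<open>1\<close> and \<open>2\<close> are attained by the central elements \<open>1\<close> and \<open>b\<^sup>2\<close>, which makes every
  element of such an order adjacent to all others.
\<close>

lemma V_model_involution_mate:
  assumes n: "n \<ge> 1" and x: "x \<in> carrier (V_model n)" and ord: "group.ord (V_model n) x dvd 2"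
  obtains y where "y \<in> carrier (V_model n)" "even (snd y)"
    "group.ord (V_model n) y = group.ord (V_model n) x"
    "\<And>z. y \<otimes>\<^bsub>V_model n\<^esub> z = z \<otimes>\<^bsub>V_model n\<^esub> y"
proof -
  interpret M: group "V_model n" by (rule group_V_model[OF n])
  have c: "(0, 2) \<in> carrier (V_model n)"
    using n by (simp add: V_model_def)
  have "M.ord (0, 2) dvd 2"
    using V_model_ord_dvd_2[OF n c] by simp
  moreover have "M.ord (0, 2) \<noteq> 1"
    using M.ord_eq_1[OF c] by (simp add: one_V_model)
  ultimately have ord2: "M.ord (0, 2) = 2"
    by (auto elim: dvd_2_cases)
  have central: "(0, t) \<otimes>\<^bsub>V_model n\<^esub> z = z \<otimes>\<^bsub>V_model n\<^esub> (0, t)" if "even t" for t z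
    using that by (simp add: mult_V_model V_mult_def add.commute)
  consider "M.ord x = 1" | "M.ord x = 2"
    using ord by (rule dvd_2_cases)
  then show ?thesis
  proof cases
    case 1
    then show ?thesis
      using that[of "(0, 0)"] central[of 0] x M.one_closed M.ord_eq_1[OF M.one_closed] by (simp add: one_V_model)
  next
    case 2
    then show ?thesis
      using that[of "(0, 2)"] central[of 2] c ord2 by simp
  qed
qed

section \<open>The graph for even parameter\<close>

text \<open>
  For even \<open>n\<close> the order \<open>4\<close> is attained in \<open>A\<close> as well, by \<open>a\<^bsup>n/2\<^esup>\<close>; so every order is.
\<close>

lemma V_model_even_mate:
  assumes n: "n \<ge> 1" "even n" and x: "x \<in> carrier (V_model n)"
  obtains y where "y \<in> carrier (V_model n)" "even (snd y)"
    "group.ord (V_model n) y = group.ord (V_model n) x"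
proof (cases "even (snd x)")
  case True
  then show ?thesis using that x by blast
next
  case False
  then have "group.ord (V_model n) x dvd 4"
    using V_model_ord_dvd_4[OF n(1) x] by simp
  then consider "group.ord (V_model n) x dvd 2" | "group.ord (V_model n) x = 4"
    by (rule dvd_4_cases) auto
  then show ?thesis
  proof cases
    case 1
    then show ?thesis using V_model_involution_mate[OF n(1) x] that by metis
  next
    case 2
    obtain m where m: "n = 2 * m" using n(2) by blast
    let ?y = "(int m, 0)"
    have y: "?y \<in> carrier (V_model n)"
      using n by (simp add: V_model_def m)
    have "group.ord (V_model n) ?y dvd 4"
      using V_model_ord_dvd_4[OF n(1) y] by (simp add: m)
    moreover have "\<not> group.ord (V_model n) ?y dvd 2"
      using V_model_ord_dvd_2[OF n(1) y] n(1) zdvd_imp_le[of "2 * int m" "int m"] by (auto simp: m)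
    ultimately have "group.ord (V_model n) ?y = 4"
      by (auto elim: dvd_4_cases)
    then show ?thesis using that[of ?y] y 2 by simp
  qed
qed

lemma finite_V_model: "finite (carrier (V_model n))"
  by (simp add: V_model_def)

lemma card_V_model: "card (carrier (V_model n)) = 8 * n"
  by (simp add: V_model_def)

lemma OSCom_V_model_even:
  assumes n: "n \<ge> 1" "even n"
  shows "digraph_iso (with_proj (OSCom (V_model n))) (with_proj (complete_graph (8 * n)))"
proof -
  have "os_commute (V_model n) u v" if "u \<in> carrier (V_model n)" "v \<in> carrier (V_model n)" for u v
    using that by (metis V_model_even_mate[OF n] V_model_commute_even os_commuteI)
  then have "parcs (OSCom (V_model n)) =
      {(u, v). u \<in> pverts (OSCom (V_model n)) \<and> v \<in> pverts (OSCom (V_model n)) \<and> u \<noteq> v}"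
    by (auto simp: parcs_OSCom pverts_OSCom)
  from digraph_iso_complete_graphI[OF _ this] show ?thesis
    by (simp add: pverts_OSCom finite_V_model card_V_model)
qed

section \<open>The graph for odd parameter\<close>

text \<open>
  For odd \<open>n\<close> the condition \<open>n dvd 2 * i\<close> for \<open>a\<^sup>i b\<^sup>s \<in> A\<close> to have order dividing \<open>4\<close> is the same
  as the condition \<open>n dvd i\<close> for order dividing \<open>2\<close>, so \<open>A\<close> has no element of order \<open>4\<close>.
\<close>

lemma V_model_ord_eq_4_iff:
  assumes n: "odd n" and x: "x \<in> carrier (V_model n)"
  shows "group.ord (V_model n) x = 4 \<longleftrightarrow> odd (snd x) \<and> even (fst x)"
proof -
  have n1: "n \<ge> 1" using n by (cases n) auto
  have "coprime (int n) 2"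
    using n by simp
  then have "int n dvd 2 * fst x \<longleftrightarrow> int n dvd fst x"
    by (rule coprime_dvd_mult_right_iff)
  moreover have "group.ord (V_model n) x = 4 \<longleftrightarrow>
      group.ord (V_model n) x dvd 4 \<and> \<not> group.ord (V_model n) x dvd 2"
    by (auto elim: dvd_4_cases)
  ultimately show ?thesis
    by (auto simp: V_model_ord_dvd_2[OF n1 x] V_model_ord_dvd_4[OF n1 x])
qed

lemma card_parity:
  "card {i \<in> {0..<2 * int n}. even i} = n" "card {i \<in> {0..<2 * int n}. odd i} = n"
proof -
  have "{i \<in> {0..<2 * int n}. even i} = (\<lambda>k. 2 * k) ` {0..<int n}"
    by (auto elim!: evenE)
  then show "card {i \<in> {0..<2 * int n}. even i} = n"
    by (simp add: card_image inj_on_def)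
  have "{i \<in> {0..<2 * int n}. odd i} = (\<lambda>k. 2 * k + 1) ` {0..<int n}"
    by (auto elim!: oddE)
  then show "card {i \<in> {0..<2 * int n}. odd i} = n"
    by (simp add: card_image inj_on_def)
qed

lemma card_V_model_ord_4:
  assumes n: "odd n"
  shows "card {x \<in> carrier (V_model n). group.ord (V_model n) x = 4} = 2 * n"
proof -
  have "{x \<in> carrier (V_model n). group.ord (V_model n) x = 4} =
      {i \<in> {0..<2 * int n}. even i} \<times> {1, 3}"
    by (auto simp: V_model_ord_eq_4_iff[OF n] cong: conj_cong) (auto simp: V_model_def, presburger+)
  then show ?thesis
    using card_parity[of n] by (simp add: card_cartesian_product)
qed

text \<open>
  There are \<open>2n\<close> involutions outside \<open>A\<close>; inside \<open>A\<close> the solutions of \<open>x\<^sup>2 = 1\<close> form the Klein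
  four-group generated by \<open>a\<^sup>n\<close> and \<open>b\<^sup>2\<close>.
\<close>

lemma card_V_model_ord_dvd_2:
  assumes n: "odd n"
  shows "card {x \<in> carrier (V_model n). group.ord (V_model n) x dvd 2} = 2 * n + 4"
proof -
  have n1: "n \<ge> 1" using n by (cases n) auto
  have multiple: "int n dvd i \<longleftrightarrow> i = 0 \<or> i = int n" if "0 \<le> i" "i < 2 * int n" for i
  proof
    assume "int n dvd i"
    then obtain k where k: "i = int n * k" by blast
    then have "0 \<le> k" "k < 2"
      using that n1 by (auto simp: zero_le_mult_iff mult.commute[of 2])
    then have "k = 0 \<or> k = 1" by arith
    then show "i = 0 \<or> i = int n" using k by auto
  qed auto
  have "{x \<in> carrier (V_model n). group.ord (V_model n) x dvd 2} =
      {i \<in> {0..<2 * int n}. odd i} \<times> {1, 3} \<union> {0, int n} \<times> {0, 2}" (is "?D = ?E")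
  proof (rule Set.set_eqI)
    fix x :: "int \<times> int"
    obtain i s where x: "x = (i, s)" by (cases x)
    have "x \<in> ?D \<longleftrightarrow> 0 \<le> i \<and> i < 2 * int n \<and> 0 \<le> s \<and> s < 4 \<and> (if even s then int n dvd i else odd i)"
      using V_model_ord_dvd_2[OF n1, of x] by (auto simp: x V_model_def)
    also have "\<dots> \<longleftrightarrow> 0 \<le> i \<and> i < 2 * int n \<and> (s = 0 \<or> s = 1 \<or> s = 2 \<or> s = 3) \<and>
        (if even s then i = 0 \<or> i = int n else odd i)"
      using multiple by (auto; arith)
    also have "\<dots> \<longleftrightarrow> x \<in> ?E"
      using n1 by (auto simp: x)
    finally show "x \<in> ?D \<longleftrightarrow> x \<in> ?E" .
  qed
  moreover have "card ?E = 2 * n + 4"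
    using card_parity[of n] n1
    by (subst card_Un_disjoint) (auto simp: card_cartesian_product simp del: atLeastLessThan_iff)
  ultimately show ?thesis by simp
qed

text \<open>
  The partition is by order: \<open>D\<close> for orders \<open>1\<close> and \<open>2\<close>, \<open>X\<close> for order \<open>4\<close>, \<open>Y\<close> for all others. Since
  orders are preserved when passing to the commuting witnesses, an edge between \<open>X\<close> and \<open>Y\<close> would
  give a commuting pair with one member in each.
\<close>

lemma OSCom_V_model_odd:
  assumes n: "odd n"
  shows "digraph_iso (with_proj (OSCom (V_model n)))
    (with_proj (graph_join (complete_graph (2 * n + 4))
      (graph_disjoint_union (complete_graph (2 * n)) (complete_graph (4 * n - 4)))))"
proof -
  have n1: "n \<ge> 1" using n by (cases n) auto
  let ?M = "V_model n"
  let ?ord = "group.ord ?M"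
  define D X Y where "D = {x \<in> carrier ?M. ?ord x dvd 2}"
    and "X = {x \<in> carrier ?M. ?ord x = 4}" and "Y = {x \<in> carrier ?M. \<not> ?ord x dvd 4}"
  have part: "carrier ?M = D \<union> X \<union> Y" "D \<inter> X = {}" "D \<inter> Y = {}" "X \<inter> Y = {}"
    by (auto simp: D_def X_def Y_def elim: dvd_4_cases intro: dvd_trans[of _ 2 4])
  have fin: "finite D" "finite X" "finite Y"
    using finite_V_model by (auto simp: D_def X_def Y_def)
  have card: "card D = 2 * n + 4" "card X = 2 * n"
    using card_V_model_ord_dvd_2[OF n] card_V_model_ord_4[OF n] by (simp_all add: D_def X_def)
  have "8 * n = card D + card X + card Y"
    unfolding card_V_model[symmetric] part(1)
    using part fin by (subst card_Un_disjoint; auto simp: card_Un_disjoint)+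
  then have cardY: "card Y = 4 * n - 4"
    using card by simp
  have Y_even: "even (snd y)" if "y \<in> carrier ?M" "\<not> ?ord y dvd 4" for y
    using that V_model_ord_dvd_4[OF n1] by blast
  have sep: "\<not> os_commute ?M x y" if "x \<in> X" "y \<in> Y" for x y
  proof
    assume "os_commute ?M x y"
    moreover have "?ord x = 4" "\<not> ?ord y dvd 4"
      using that by (auto simp: X_def Y_def)
    ultimately obtain x' y' where x': "x' \<in> carrier ?M" "?ord x' = 4"
      and y': "y' \<in> carrier ?M" "\<not> ?ord y' dvd 4"
      and comm: "x' \<otimes>\<^bsub>?M\<^esub> y' = y' \<otimes>\<^bsub>?M\<^esub> x'"
      unfolding os_commute_def by (metis dvd_refl)
    have "odd (snd x')"
      using x' V_model_ord_eq_4_iff[OF n] by blast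
    then have "?ord y' dvd 2"
      using V_model_commute_odd[OF n1 y'(1) Y_even[OF y'] _ comm] by blast
    then show False
      using y'(2) dvd_trans[of "?ord y'" 2 4] by simp
  qed
  have mate: "\<exists>y\<in>carrier ?M. even (snd y) \<and> ?ord y = ?ord x" if "x \<in> D \<union> Y" for x
    using that Y_even V_model_involution_mate[OF n1] unfolding D_def Y_def by blast
  have DY: "os_commute ?M u v" if "u \<in> D \<union> Y" "v \<in> D \<union> Y" for u v
    using mate[OF that(1)] mate[OF that(2)] V_model_commute_even by (metis os_commuteI)
  have DX: "os_commute ?M u v" if uv: "u \<in> D" "v \<in> X" for u v
  proof -
    obtain y where "y \<in> carrier ?M" "?ord y = ?ord u" "y \<otimes>\<^bsub>?M\<^esub> v = v \<otimes>\<^bsub>?M\<^esub> y"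
      using uv(1) V_model_involution_mate[OF n1, of u] unfolding D_def by blast
    then show ?thesis
      using uv(2) by (intro os_commuteI[of y _ v]) (auto simp: X_def)
  qed
  have XX: "os_commute ?M u v" if "u \<in> X" "v \<in> X" for u v
    using that by (simp add: X_def os_commute_def)
  have "os_commute ?M u v \<longleftrightarrow> \<not> (u \<in> X \<and> v \<in> Y) \<and> \<not> (u \<in> Y \<and> v \<in> X)"
    if "u \<in> carrier ?M" "v \<in> carrier ?M" for u v
    using that sep DY DX XX os_commute_sym[of ?M] unfolding part(1) by blast
  then have "parcs (OSCom ?M) = {(u, v). u \<in> pverts (OSCom ?M) \<and> v \<in> pverts (OSCom ?M) \<and> u \<noteq> v \<and>
      \<not> (u \<in> X \<and> v \<in> Y) \<and> \<not> (u \<in> Y \<and> v \<in> X)}"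
    unfolding parcs_OSCom pverts_OSCom by blast
  from digraph_iso_join_completeI[OF _ _ part(2-4) this] show ?thesis
    using part(1) fin by (simp add: pverts_OSCom card cardY)
qed

section \<open>The order super commuting graph\<close>

theorem theorem2p12:
  fixes n :: nat
  assumes "n \<ge> 1"
  shows "(even n \<longrightarrow>
            digraph_iso (with_proj (OSCom (V8n n))) (with_proj (complete_graph (8 * n)))) \<and>
         (odd n \<longrightarrow>
            digraph_iso (with_proj (OSCom (V8n n)))
              (with_proj
                (graph_join (complete_graph (2 * n + 4))
                  (graph_disjoint_union (complete_graph (2 * n)) (complete_graph (4 * n - 4))))))"
proof -
  obtain h where h: "h \<in> iso (V8n n) (V_model n)"
    using V8n_iso_V_model[OF assms] by blast
  have "group (V8n n)"
    unfolding V8n_eq by (rule group_presented_group)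
  note transfer = digraph_iso_trans[OF OSCom_iso[OF this group_V_model[OF assms] h]]
  show ?thesis
    by (intro conjI impI transfer OSCom_V_model_even OSCom_V_model_odd assms)
qed

end
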